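(* Let $G=(V,E)$ be a $\tau$-critical graph of order $n$ with $\tau(G)=t$. Then \[ |V|+|E|\leq \binom{t+2}{2}. \] Furthermore, equality holds if and only if $G\cong K_n$ for some $n\geq 2$, or $G\cong 2K_2$, or $G\cong C_5$.
   Context: All graphs are finite and simple. A transversal set of a graph $G$ is a set of vertices meeting every edge of $G$; the transversal number $\tau(G)$ is the minimum cardinality of a transversal set of $G$. A simple graph $G=(V,E)$ with no isolated vertex is called $\tau$-critical if $\tau(G-e)=\tau(G)-1$ for every edge $e\in E$, where $G-e=(V,E\setminus\{e\})$. $K_n$ denotes the complete graph on $n$ vertices, $2K_2$ the disjoint union of two edges (a graph on four vertices with two disjoint edges), and $C_5$ the cycle on five vertices. *)

theory Defs
  imports Main
begin

record 'a ugraph =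
  verts :: "'a set"
  edges :: "'a set set"

definition finite_simple_graph :: "'a ugraph \<Rightarrow> bool" where
  "finite_simple_graph G \<longleftrightarrow>
     finite (verts G) \<and> (\<forall>e\<in>edges G. e \<subseteq> verts G \<and> card e = 2)"

definition no_isolated_vertex :: "'a ugraph \<Rightarrow> bool" where
  "no_isolated_vertex G \<longleftrightarrow> (\<forall>v\<in>verts G. \<exists>e\<in>edges G. v \<in> e)"

definition delete_edge :: "'a ugraph \<Rightarrow> 'a set \<Rightarrow> 'a ugraph" where
  "delete_edge G e = \<lparr>verts = verts G, edges = edges G - {e}\<rparr>"

definition transversal_set :: "'a ugraph \<Rightarrow> 'a set \<Rightarrow> bool" where
  "transversal_set G T \<longleftrightarrow> T \<subseteq> verts G \<and> (\<forall>e\<in>edges G. T \<inter> e \<noteq> {})"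

definition transversal_number :: "'a ugraph \<Rightarrow> nat" where
  "transversal_number G = (LEAST k. \<exists>T. transversal_set G T \<and> card T = k)"

text \<open>
  The criticality condition is written additively rather than with the truncated
  subtraction on natural numbers. The graph without vertices is vacuously critical.
\<close>

definition tau_critical :: "'a ugraph \<Rightarrow> bool" where
  "tau_critical G \<longleftrightarrow>
     finite_simple_graph G \<and> no_isolated_vertex G \<and>
     (\<forall>e\<in>edges G. transversal_number (delete_edge G e) + 1 = transversal_number G)"

definition graph_isomorphic :: "'a ugraph \<Rightarrow> 'b ugraph \<Rightarrow> bool" (infix "\<cong>\<^sub>g" 50) where
  "G \<cong>\<^sub>g H \<longleftrightarrow>
     (\<exists>f. bij_betw f (verts G) (verts H) \<and>
        (\<forall>u\<in>verts G. \<forall>v\<in>verts G. {u, v} \<in> edges G \<longleftrightarrow> {f u, f v} \<in> edges H))"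

definition complete_graph :: "nat \<Rightarrow> nat ugraph" where
  "complete_graph n = \<lparr>verts = {..<n}, edges = {{i, j} | i j. i < n \<and> j < n \<and> i \<noteq> j}\<rparr>"

definition two_K2 :: "nat ugraph" where
  "two_K2 = \<lparr>verts = {0, 1, 2, 3}, edges = {{0, 1}, {2, 3}}\<rparr>"

text \<open>This is a simple graph, the cycle on \<open>n\<close> vertices, only for \<open>n \<ge> 3\<close>.\<close>

definition cycle_graph :: "nat \<Rightarrow> nat ugraph" where
  "cycle_graph n = \<lparr>verts = {..<n}, edges = {{i, (i + 1) mod n} | i. i < n}\<rparr>"

end

theory Submission
  imports Defs
begin

text \<open>
  Let \<open>\<alpha> = n - t\<close> be the independence number. Hajnal's theorem says that every vertex has degree
  at most \<open>n - 2\<alpha> + 1 = 2t - n + 1\<close>. Summing over the vertices,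
  \<open>2(|V| + |E|) \<le> n(2t + 3 - n) = (t + 1)(t + 2) - (n - t - 1)(n - t - 2)\<close>.
  Equality forces regularity and \<open>n = t + 1\<close>, so that \<open>G\<close> is complete, or \<open>n = t + 2\<close>. In the
  latter case \<open>\<alpha> = 2\<close> and the complement of \<open>G\<close> is 2-regular and triangle-free, and criticality
  gives any two vertices adjacent in \<open>G\<close> a common neighbour in the complement; hence the
  complement is a 4-cycle or a 5-cycle.

  Hajnal's theorem: for each neighbour \<open>y\<close> of \<open>v\<close> take a maximum independent set \<open>S y\<close>
  in which \<open>y\<close> is the only neighbour of \<open>v\<close>. Let \<open>U\<close> be the union of these sets and \<open>I\<close> their
  intersection without the neighbours of \<open>v\<close>. Then \<open>|U| + |I| \<ge> 2\<alpha> + deg v - 2\<close>, while \<open>U\<close>,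
  \<open>{v}\<close> and the neighbourhood of \<open>I\<close>, which has at least \<open>|I|\<close> elements, are disjoint.
\<close>

section \<open>Neighbourhoods, independent sets, degree sums and transversals\<close>

definition nbrs :: "'a ugraph \<Rightarrow> 'a \<Rightarrow> 'a set" where
  "nbrs G v = {u. {v, u} \<in> edges G}"

definition indep :: "'a ugraph \<Rightarrow> 'a set \<Rightarrow> bool" where
  "indep G S \<longleftrightarrow> S \<subseteq> verts G \<and> (\<forall>u\<in>S. \<forall>v\<in>S. v \<notin> nbrs G u)"

lemma nbrs_sym: "u \<in> nbrs G v \<longleftrightarrow> v \<in> nbrs G u"
  by (simp add: nbrs_def insert_commute)

lemma nbrs_irrefl: "finite_simple_graph G \<Longrightarrow> v \<notin> nbrs G v"
  by (auto simp: nbrs_def finite_simple_graph_def)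

lemma nbrs_subset: "finite_simple_graph G \<Longrightarrow> nbrs G v \<subseteq> verts G"
  by (auto simp: nbrs_def finite_simple_graph_def)

lemma finite_edges: "finite_simple_graph G \<Longrightarrow> finite (edges G)"
  by (rule finite_subset[of _ "Pow (verts G)"]) (auto simp: finite_simple_graph_def)

lemma card_edges_at:
  assumes "finite_simple_graph G"
  shows "card {e \<in> edges G. v \<in> e} = card (nbrs G v)"
proof -
  have "inj_on (\<lambda>u. {v, u}) (nbrs G v)"
    by (auto simp: inj_on_def doubleton_eq_iff)
  moreover have "{e \<in> edges G. v \<in> e} = (\<lambda>u. {v, u}) ` nbrs G v"
  proof (intro set_eqI iffI)
    fix e assume e: "e \<in> {e \<in> edges G. v \<in> e}"
    then have "card e = 2" using assms by (simp add: finite_simple_graph_def)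
    then obtain a b where "e = {a, b}" by (auto simp: card_2_iff)
    with e show "e \<in> (\<lambda>u. {v, u}) ` nbrs G v"
      by (auto simp: nbrs_def insert_commute)
  qed (auto simp: nbrs_def)
  ultimately show ?thesis by (simp add: card_image)
qed

lemma sum_degrees:
  assumes "finite_simple_graph G"
  shows "(\<Sum>v\<in>verts G. card (nbrs G v)) = 2 * card (edges G)"
proof -
  have fin: "finite (verts G)" using assms by (simp add: finite_simple_graph_def)
  have "(\<Sum>v\<in>verts G. card {e \<in> edges G. v \<in> e}) = 2 * card (edges G)"
  proof (rule sum_multicount[OF fin finite_edges[OF assms]], intro ballI)
    fix e assume "e \<in> edges G"
    then have "e \<subseteq> verts G" "card e = 2" using assms by (auto simp: finite_simple_graph_def)
    moreover from this have "{v \<in> verts G. v \<in> e} = e" by auto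
    ultimately show "card {v \<in> verts G. v \<in> e} = 2" by simp
  qed
  then show ?thesis by (simp add: card_edges_at[OF assms])
qed

lemma transversal_number_le: "transversal_set G T \<Longrightarrow> transversal_number G \<le> card T"
  unfolding transversal_number_def by (rule Least_le) blast

lemma transversal_number_attained:
  assumes "finite_simple_graph G"
  obtains T where "transversal_set G T" "card T = transversal_number G"
proof -
  \<comment> \<open>Edges are nonempty, so the whole vertex set is a transversal and the
    \<open>LEAST\<close> ranges over a nonempty set of sizes.\<close>
  have "e \<noteq> {}" if "e \<in> edges G" for e
    using that assms by (auto simp: finite_simple_graph_def)
  then have "transversal_set G (verts G)"
    using assms unfolding transversal_set_def finite_simple_graph_def by blast
  then have "\<exists>T. transversal_set G T \<and> card T = transversal_number G"
    unfolding transversal_number_def by (intro LeastI_ex[of "\<lambda>k. \<exists>T. transversal_set G T \<and> card T = k"]) blast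
  then show ?thesis using that by blast
qed

lemma transversal_complement:
  assumes "indep G S" "finite_simple_graph G"
  shows "transversal_set G (verts G - S)"
  unfolding transversal_set_def
proof (intro conjI ballI)
  fix e assume e: "e \<in> edges G"
  then obtain a b where ab: "e = {a, b}" "{a, b} \<subseteq> verts G"
    using assms(2) unfolding finite_simple_graph_def card_2_iff by metis
  then have "a \<notin> S \<or> b \<notin> S" using assms(1) e by (auto simp: indep_def nbrs_def)
  with ab show "(verts G - S) \<inter> e \<noteq> {}" by auto
qed simp

section \<open>Independent sets in critical graphs, up to Hajnal's degree bound\<close>

text \<open>Deleting the edge \<open>uv\<close> creates an independent set of \<open>\<alpha> + 1\<close> elements containing both ends;
  the set \<open>A\<close> in the last assumption is this set without \<open>u\<close>.\<close>

locale alpha_critical =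
  fixes G :: "'a ugraph" and \<alpha> :: nat
  assumes simple: "finite_simple_graph G"
    and nonisolated: "v \<in> verts G \<Longrightarrow> nbrs G v \<noteq> {}"
    and indep_le: "indep G S \<Longrightarrow> card S \<le> \<alpha>"
    and critical: "v \<in> nbrs G u \<Longrightarrow> \<exists>A. indep G A \<and> card A = \<alpha> \<and> u \<notin> A \<and> A \<inter> nbrs G u = {v}"
begin

lemma fin_verts: "finite (verts G)"
  using simple by (simp add: finite_simple_graph_def)

text \<open>Induction on the size of \<open>X\<close>, with N(X) the union of the neighbourhoods. A
  maximum independent set \<open>A\<close> missing some point of \<open>X\<close> cannot grow when
  \<open>A \<inter> N(X)\<close> is exchanged for \<open>X - A\<close>, so |X - A| \<le> |A \<inter>
  N(X)|. The rest \<open>X \<inter> A\<close> is smaller than \<open>X\<close>, and its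
  neighbourhood avoids \<open>A\<close>, so the two estimates add up inside N(X).\<close>

lemma indep_card_le_nbrs: "indep G X \<Longrightarrow> card X \<le> card (\<Union>x\<in>X. nbrs G x)"
proof (induction "card X" arbitrary: X rule: less_induct)
  case less
  let ?N = "\<lambda>X. \<Union>x\<in>X. nbrs G x"
  have finN: "finite (?N X)" for X
    by (rule finite_subset[OF _ fin_verts]) (use nbrs_subset[OF simple] in blast)
  have finX: "finite X" using less.prems fin_verts by (auto simp: indep_def intro: finite_subset)
  show ?case
  proof (cases "X = {}")
    case False
    then obtain x where x: "x \<in> X" by blast
    then obtain z where "z \<in> nbrs G x" using nonisolated less.prems by (fastforce simp: indep_def)
    \<comment> \<open>The edge \<open>xz\<close> serves only to produce a maximum independent set
      without \<open>x\<close>, which makes \<open>X \<inter> A\<close> a proper subset of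
      \<open>X\<close>.\<close>
    then obtain A where A: "indep G A" "card A = \<alpha>" "x \<notin> A" using critical by blast
    have finA: "finite A" using A fin_verts by (auto simp: indep_def intro: finite_subset)
    have "card (X \<inter> A) < card X" using x A finX by (intro psubset_card_mono) auto
    moreover have "indep G (X \<inter> A)" using A by (auto simp: indep_def)
    ultimately have IH: "card (X \<inter> A) \<le> card (?N (X \<inter> A))" using less.hyps by blast
    have "indep G ((A - ?N X) \<union> X)"
      using A(1) less.prems nbrs_sym[of _ G] unfolding indep_def by blast
    then have "card ((A - ?N X) \<union> X) \<le> \<alpha>" by (rule indep_le)
    moreover have "(A - ?N X) \<union> X = (A - ?N X) \<union> (X - A)"
      using less.prems by (auto simp: indep_def)
    moreover have "card ((A - ?N X) \<union> (X - A)) = card (A - ?N X) + card (X - A)"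
      using finA finX by (intro card_Un_disjoint) auto
    moreover have "card A = card (A - ?N X) + card (A \<inter> ?N X)"
      using finA by (subst add.commute) (rule card_Int_Diff)
    ultimately have 1: "card (X - A) \<le> card (A \<inter> ?N X)" using A(2) by simp
    have "card X = card (X - A) + card (X \<inter> A)"
      using finX by (subst add.commute) (rule card_Int_Diff)
    also have "\<dots> \<le> card (A \<inter> ?N X) + card (?N (X \<inter> A))" using 1 IH by simp
    also have "\<dots> = card ((A \<inter> ?N X) \<union> ?N (X \<inter> A))"
      using finA finN A(1) by (intro card_Un_disjoint[symmetric]) (auto simp: indep_def)
    also have "\<dots> \<le> card (?N X)" using finN by (intro card_mono) auto
    finally show ?thesis .
  qed simp
qed

text \<open>The gain of one comes from adjoining \<open>v\<close> to the independent set \<open>I \<union> (A \<inter> U)\<close>.\<close>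

lemma exchange:
  assumes v: "v \<in> verts G" and A: "indep G A" "card A = \<alpha>" "v \<notin> A" "A \<inter> nbrs G v = {y}"
    and U: "U \<subseteq> verts G" "y \<notin> U" and I: "I \<subseteq> U" "v \<notin> I" "I \<inter> nbrs G v = {}"
    and IU: "\<And>a b. a \<in> I \<Longrightarrow> b \<in> U \<Longrightarrow> b \<notin> nbrs G a"
  shows "card U + card I + 1 \<le> card (U \<union> A) + card (I \<inter> A)"
proof -
  have fin: "finite U" "finite I" "finite A"
    using U I A(1) fin_verts by (auto simp: indep_def intro: finite_subset)
  let ?W = "(I - A) \<union> (A \<inter> U)"
  have WU: "?W \<subseteq> U" using I by blast
  \<comment> \<open>The only neighbour of \<open>v\<close> in \<open>A\<close> is \<open>y\<close>,
    which lies outside \<open>U\<close>, and \<open>I\<close> contains no neighbour of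
    \<open>v\<close>.\<close>
  have vW: "b \<notin> nbrs G v" if "b \<in> ?W" for b
  proof
    assume b: "b \<in> nbrs G v"
    then have bA: "b \<in> A" "b \<in> U" using that I(3) by blast+
    then have "b \<in> A \<inter> nbrs G v" using b by simp
    then show False using A(4) U(2) bA(2) by simp
  qed
  have WW: "b \<notin> nbrs G a" if "a \<in> ?W" "b \<in> ?W" for a b
  proof (cases "a \<in> A \<and> b \<in> A")
    case True then show ?thesis using A(1) by (simp add: indep_def)
  next
    case False
    then have "a \<in> I \<or> b \<in> I" using that by blast
    then show ?thesis using IU[of a b] IU[of b a] WU that nbrs_sym[of a G b] by blast
  qed
  have "indep G (insert v ?W)"
    unfolding indep_def
  proof (intro conjI ballI)
    show "insert v ?W \<subseteq> verts G" using v WU U by blast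
  next
    fix a b assume "a \<in> insert v ?W" "b \<in> insert v ?W"
    then show "b \<notin> nbrs G a"
      using vW WW nbrs_sym[of b G a] nbrs_irrefl[OF simple, of v] by (metis insertE)
  qed
  then have "card (insert v ?W) \<le> \<alpha>" by (rule indep_le)
  moreover have "v \<notin> ?W" using I A by blast
  moreover have "card ?W = card (I - A) + card (A \<inter> U)"
    using fin by (intro card_Un_disjoint) auto
  \<comment> \<open>Since |A| = \<alpha>, this says |I - A| < |A - U|: the union with
    \<open>A\<close> gains more than the intersection with \<open>A\<close> loses.\<close>
  ultimately have "card (I - A) + card (A \<inter> U) + 1 \<le> \<alpha>"
    using fin by simp
  moreover have "card A = card (A \<inter> U) + card (A - U)" "card I = card (I \<inter> A) + card (I - A)"
    using fin by (auto intro: card_Int_Diff)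
  moreover have "card (U \<union> (A - U)) = card U + card (A - U)"
    using fin by (intro card_Un_disjoint) auto
  ultimately show ?thesis using A(2) by simp
qed

text \<open>Induction on \<open>Y\<close>. A single set contributes \<alpha> to the union and
  \<alpha> - 1 to the intersection, because removing the neighbours of \<open>v\<close> takes away
  just \<open>y\<close>. By \<open>exchange\<close>, each further neighbour raises the sum of the
  two sizes by at least one.\<close>

lemma card_Union_Inter_ge:
  assumes v: "v \<in> verts G"
    and S: "\<And>y. y \<in> nbrs G v \<Longrightarrow>
      indep G (S y) \<and> card (S y) = \<alpha> \<and> v \<notin> S y \<and> S y \<inter> nbrs G v = {y}"
    and Y: "finite Y" "Y \<noteq> {}" "Y \<subseteq> nbrs G v"
  shows "2 * \<alpha> + card Y \<le> card (\<Union>y\<in>Y. S y) + card ((\<Inter>y\<in>Y. S y) - nbrs G v) + 2"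
  using Y
proof (induction rule: finite_ne_induct)
  case (singleton y)
  then have y: "indep G (S y)" "card (S y) = \<alpha>" "S y \<inter> nbrs G v = {y}" using S by auto
  then have "S y - nbrs G v = S y - {y}" "y \<in> S y" by auto
  then show ?case using y by (simp add: card_Diff_singleton)
next
  case (insert y Y)
  define U where "U = (\<Union>y\<in>Y. S y)"
  define I where "I = (\<Inter>y\<in>Y. S y) - nbrs G v"
  have y: "indep G (S y)" "card (S y) = \<alpha>" "v \<notin> S y" "S y \<inter> nbrs G v = {y}"
    using S insert.prems by auto
  have SY: "indep G (S x)" "S x \<inter> nbrs G v = {x}" "v \<notin> S x" if "x \<in> Y" for x
    using S insert.prems that by auto
  have IS: "I \<subseteq> S x" if "x \<in> Y" for x using that unfolding I_def by blast
  obtain x where x: "x \<in> Y" using insert.hyps by blast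
  have "card U + card I + 1 \<le> card (U \<union> S y) + card (I \<inter> S y)"
  proof (rule exchange[OF v y])
    show "U \<subseteq> verts G" unfolding U_def using SY(1) by (intro UN_least) (simp add: indep_def)
    show "y \<notin> U"
    proof
      assume "y \<in> U"
      then obtain x where x: "x \<in> Y" "y \<in> S x" unfolding U_def by blast
      then have "y \<in> S x \<inter> nbrs G v" using insert.prems by simp
      then show False using SY(2)[OF x(1)] x(1) insert.hyps by simp
    qed
    show "I \<subseteq> U" using x IS[OF x] unfolding U_def by blast
    show "v \<notin> I" using IS[OF x] SY(3)[OF x] by blast
    show "I \<inter> nbrs G v = {}" unfolding I_def by blast
    show "b \<notin> nbrs G a" if ab: "a \<in> I" "b \<in> U" for a b
    proof -
      obtain x where x: "x \<in> Y" "b \<in> S x" using ab(2) unfolding U_def by blast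
      then show ?thesis using SY(1)[OF x(1)] IS[OF x(1)] ab(1) unfolding indep_def by blast
    qed
  qed
  moreover have "(\<Union>x\<in>insert y Y. S x) = U \<union> S y" unfolding U_def by blast
  moreover have "(\<Inter>x\<in>insert y Y. S x) - nbrs G v = I \<inter> S y" unfolding I_def by blast
  moreover have "2 * \<alpha> + card Y \<le> card U + card I + 2"
    using insert.IH insert.prems unfolding U_def I_def by blast
  ultimately show ?case using insert.hyps by simp
qed

text \<open>Hajnal's theorem, in additive form so that no natural subtraction is truncated.\<close>

lemma degree_bound:
  assumes v: "v \<in> verts G"
  shows "card (nbrs G v) + 2 * \<alpha> \<le> card (verts G) + 1"
proof -
  have "\<exists>S. \<forall>y\<in>nbrs G v. indep G (S y) \<and> card (S y) = \<alpha> \<and> v \<notin> S y \<and> S y \<inter> nbrs G v = {y}"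
    by (rule bchoice) (use critical in blast)
  then obtain S where S: "\<And>y. y \<in> nbrs G v \<Longrightarrow>
      indep G (S y) \<and> card (S y) = \<alpha> \<and> v \<notin> S y \<and> S y \<inter> nbrs G v = {y}" by blast
  let ?U = "\<Union>y\<in>nbrs G v. S y" and ?I = "(\<Inter>y\<in>nbrs G v. S y) - nbrs G v"
  let ?N = "\<Union>x\<in>?I. nbrs G x"
  have ne: "nbrs G v \<noteq> {}" using nonisolated v by blast
  have UV: "?U \<subseteq> verts G" using S unfolding indep_def by blast
  have NV: "?N \<subseteq> verts G" using nbrs_subset[OF simple] by blast
  have fins: "finite ?U" "finite ?N" using UV NV fin_verts finite_subset by blast+
  have le: "2 * \<alpha> + card (nbrs G v) \<le> card ?U + card ?I + 2"
    using v S by (rule card_Union_Inter_ge) (use ne nbrs_subset[OF simple] fin_verts finite_subset in blast)+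
  obtain y where y: "y \<in> nbrs G v" using ne by blast
  have "indep G ?I" using S[OF y] y by (auto simp: indep_def)
  then have I: "card ?I \<le> card ?N" by (rule indep_card_le_nbrs)
  \<comment> \<open>A point of \<open>?I\<close> belongs to every \<open>S w\<close>, so by
    independence none of its neighbours lies in any \<open>S w\<close>.\<close>
  have dis: "?N \<inter> ?U = {}"
  proof (rule ccontr)
    assume "?N \<inter> ?U \<noteq> {}"
    then obtain x z w where x: "x \<in> ?I" "z \<in> nbrs G x" "w \<in> nbrs G v" "z \<in> S w" by blast
    then have "x \<in> S w" by blast
    with x S[of w] show False by (auto simp: indep_def)
  qed
  have "v \<notin> ?U" using S by blast
  \<comment> \<open>This is why the neighbours of \<open>v\<close> were removed from the
    intersection.\<close>
  moreover have "v \<notin> ?N" using nbrs_sym[of v] by blast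
  ultimately have "card (insert v (?N \<union> ?U)) = card ?N + card ?U + 1"
    using fins card_Un_disjoint[OF fins(2,1) dis] by simp
  moreover have "card (insert v (?N \<union> ?U)) \<le> card (verts G)"
    using v UV NV fin_verts by (intro card_mono) auto
  ultimately show ?thesis using le I by linarith
qed

end

section \<open>Translation from transversals to independent sets\<close>

lemma tau_critical_alpha_critical:
  assumes "tau_critical G"
  shows "alpha_critical G (card (verts G) - transversal_number G)"
    and "transversal_number G \<le> card (verts G)"
proof -
  let ?t = "transversal_number G"
  have simple: "finite_simple_graph G" and ni: "no_isolated_vertex G"
    and crit: "\<And>e. e \<in> edges G \<Longrightarrow> transversal_number (delete_edge G e) + 1 = ?t"
    using assms by (auto simp: tau_critical_def)
  have fin: "finite (verts G)" using simple by (simp add: finite_simple_graph_def)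
  show le: "?t \<le> card (verts G)"
    using transversal_number_attained[OF simple] fin
    by (metis card_mono transversal_set_def)
  show "alpha_critical G (card (verts G) - ?t)"
  proof
    show "finite_simple_graph G" by fact
    show "nbrs G v \<noteq> {}" if v: "v \<in> verts G" for v
    proof -
      have "{e \<in> edges G. v \<in> e} \<noteq> {}" using ni v by (auto simp: no_isolated_vertex_def)
      then have "card {e \<in> edges G. v \<in> e} \<noteq> 0" using finite_edges[OF simple] by simp
      then show ?thesis using card_edges_at[OF simple] by force
    qed
    show "card S \<le> card (verts G) - ?t" if S: "indep G S" for S
    proof -
      have "?t \<le> card (verts G - S)"
        using transversal_number_le transversal_complement[OF S simple] by blast
      moreover have SV: "S \<subseteq> verts G" using S by (simp add: indep_def)
      ultimately show ?thesis using fin card_mono[OF fin SV]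
        by (simp add: card_Diff_subset finite_subset)
    qed
    show "\<exists>A. indep G A \<and> card A = card (verts G) - ?t \<and> u \<notin> A \<and> A \<inter> nbrs G u = {v}"
      if uv: "v \<in> nbrs G u" for u v
    proof -
      let ?e = "{u, v}"
      have e: "?e \<in> edges G" using uv by (simp add: nbrs_def)
      then have eV: "u \<in> verts G" "v \<in> verts G" "u \<noteq> v"
        using simple by (auto simp: finite_simple_graph_def)
      have "finite_simple_graph (delete_edge G ?e)"
        using simple by (auto simp: finite_simple_graph_def delete_edge_def)
      then obtain T where T: "transversal_set (delete_edge G ?e) T"
        "card T = transversal_number (delete_edge G ?e)"
        by (rule transversal_number_attained)
      then have cT: "card T + 1 = ?t" using crit[OF e] by simp
      have TV: "T \<subseteq> verts G" and Te: "\<And>f. f \<in> edges G \<Longrightarrow> f \<noteq> ?e \<Longrightarrow> T \<inter> f \<noteq> {}"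
        using T(1) by (auto simp: transversal_set_def delete_edge_def)
      \<comment> \<open>A set \<open>T\<close> meeting the deleted edge as well would be a
        transversal of \<open>G\<close> with only t - 1 elements.\<close>
      have dis: "T \<inter> ?e = {}"
      proof (rule ccontr)
        assume "T \<inter> ?e \<noteq> {}"
        with Te TV have "transversal_set G T" unfolding transversal_set_def by metis
        then show False using transversal_number_le cT by fastforce
      qed
      have finT: "finite T" using TV fin finite_subset by blast
      \<comment> \<open>Removing \<open>u\<close> along with \<open>T\<close> destroys the one edge
        that \<open>T\<close> misses and brings the removed set to size t. The end \<open>v\<close>
        stays, and any edge from \<open>u\<close> into \<open>?A\<close> misses \<open>T\<close>,
        hence is \<open>uv\<close>.\<close>
      let ?A = "verts G - insert u T"
      have "{a, b} \<notin> edges G" if "a \<in> ?A" "b \<in> ?A" for a b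
        using Te[of "{a, b}"] that by (auto simp: doubleton_eq_iff)
      then have "indep G ?A" by (auto simp: indep_def nbrs_def)
      moreover have "card ?A = card (verts G) - ?t"
        using dis TV eV finT cT by (subst card_Diff_subset) auto
      moreover have "w = v" if "w \<in> ?A" "w \<in> nbrs G u" for w
        using Te[of "{u, w}"] that dis by (auto simp: nbrs_def doubleton_eq_iff)
      ultimately show ?thesis using uv eV dis by (intro exI[of _ ?A]) auto
    qed
  qed
qed

section \<open>The counting inequality and its equality condition\<close>

lemma order_plus_size:
  fixes d :: "'a \<Rightarrow> nat"
  assumes "finite V" "V \<noteq> {}" and d: "\<And>v. v \<in> V \<Longrightarrow> d v + card V \<le> 2 * t + 1"
    and E: "(\<Sum>v\<in>V. d v) = 2 * E"
  shows "card V + E \<le> (t + 2) choose 2"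
    and "card V + E = (t + 2) choose 2 \<longleftrightarrow>
      (card V = t + 1 \<or> card V = t + 2) \<and> (\<forall>v\<in>V. d v + card V = 2 * t + 1)"
proof -
  let ?n = "card V"
  \<comment> \<open>Total slack in the degree bounds; assumption \<open>d\<close> makes every
    difference exact.\<close>
  define s where "s = (\<Sum>v\<in>V. 2 * t + 1 - (d v + ?n))"
  have "(\<Sum>v\<in>V. d v + ?n + (2 * t + 1 - (d v + ?n))) = (\<Sum>v\<in>V. 2 * t + 1)"
    using d by (intro sum.cong) auto
  then have s: "2 * E + ?n * ?n + s = ?n * (2 * t + 1)"
    using E by (simp add: sum.distrib s_def del: add_Suc_right)
  have c: "2 * ((t + 2) choose 2) = (t + 2) * (t + 1)"
    by (simp add: choose_two)
  let ?m = "int ?n" and ?t = "int t"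
  have s': "2 * int E + ?m * ?m + int s = ?m * (2 * ?t + 1)"
    using arg_cong[OF s, of int] by (simp add: algebra_simps)
  have c': "2 * int ((t + 2) choose 2) = (?t + 2) * (?t + 1)"
    using arg_cong[OF c, of int] by (simp add: algebra_simps)
  \<comment> \<open>A product of consecutive integers: nonnegative, and zero exactly for n = t + 1
    and n = t + 2. The first factor may be negative as far as these hypotheses go, hence the passage
    to \<open>int\<close>.\<close>
  define p where "p = (?m - ?t - 1) * (?m - ?t - 2)"
  define B where "B = int ((t + 2) choose 2)"
  have id: "2 * B = 2 * (?m + int E) + int s + p"
    using s' c' unfolding B_def p_def by (simp add: algebra_simps)
  have nonneg: "p \<ge> 0"
    unfolding p_def by (cases "?m - ?t - 1 \<le> 0") (auto intro: mult_nonpos_nonpos mult_nonneg_nonneg)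
  have "int (card V + E) \<le> B"
    using id nonneg by simp
  then show "card V + E \<le> (t + 2) choose 2"
    unfolding B_def by (simp only: of_nat_le_iff)
  have "card V + E = (t + 2) choose 2 \<longleftrightarrow> ?m + int E = B"
    unfolding B_def of_nat_add[symmetric] of_nat_eq_iff ..
  \<comment> \<open>Twice the deficit in the inequality is the sum of two nonnegative terms,
    \<open>s\<close> and \<open>p\<close>.\<close>
  also have "\<dots> \<longleftrightarrow> s = 0 \<and> p = 0"
    using id nonneg by auto
  also have "p = 0 \<longleftrightarrow> ?n = t + 1 \<or> ?n = t + 2"
    unfolding p_def by auto
  also have "s = 0 \<longleftrightarrow> (\<forall>v\<in>V. d v + ?n = 2 * t + 1)"
    using d assms(1) unfolding s_def by (auto simp: le_antisym)
  finally show "card V + E = (t + 2) choose 2 \<longleftrightarrow>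
      (card V = t + 1 \<or> card V = t + 2) \<and> (\<forall>v\<in>V. d v + card V = 2 * t + 1)" by blast
qed

section \<open>Transport along isomorphisms, and the model graphs\<close>

lemma isomorphic_degree:
  assumes "bij_betw f (verts G) (verts H)"
    "\<forall>u\<in>verts G. \<forall>v\<in>verts G. {u, v} \<in> edges G \<longleftrightarrow> {f u, f v} \<in> edges H"
    "finite_simple_graph G" "finite_simple_graph H" "v \<in> verts G"
  shows "card (nbrs G v) = card (nbrs H (f v))"
proof -
  have "nbrs H (f v) = f ` nbrs G v"
  proof (intro set_eqI iffI)
    fix w assume w: "w \<in> nbrs H (f v)"
    then have "w \<in> verts H" using nbrs_subset[OF assms(4)] by blast
    then obtain u where u: "u \<in> verts G" "w = f u" using assms(1) by (auto simp: bij_betw_def)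
    with w show "w \<in> f ` nbrs G v" using assms(2,5) by (auto simp: nbrs_def)
  next
    fix w assume "w \<in> f ` nbrs G v"
    then show "w \<in> nbrs H (f v)"
      using assms(2,5) nbrs_subset[OF assms(3)] by (fastforce simp: nbrs_def)
  qed
  moreover have "inj_on f (nbrs G v)"
    using assms(1) nbrs_subset[OF assms(3)] by (auto simp: bij_betw_def intro: inj_on_subset)
  ultimately show ?thesis by (simp add: card_image)
qed

text \<open>Carries over from a model graph to \<open>G\<close> the data that decide equality:
  order, degree and an independent set of known size.\<close>

lemma isomorphic_regular:
  assumes "G \<cong>\<^sub>g H" "finite_simple_graph G" "finite_simple_graph H"
    "\<forall>w\<in>verts H. card (nbrs H w) = k" "indep H S"
  shows "card (verts G) = card (verts H)" "\<forall>v\<in>verts G. card (nbrs G v) = k"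
    "\<exists>S'. indep G S' \<and> card S' = card S"
proof -
  obtain f where f: "bij_betw f (verts G) (verts H)"
    "\<forall>u\<in>verts G. \<forall>v\<in>verts G. {u, v} \<in> edges G \<longleftrightarrow> {f u, f v} \<in> edges H"
    using assms(1) by (auto simp: graph_isomorphic_def)
  show "card (verts G) = card (verts H)" using f(1) by (rule bij_betw_same_card)
  show "\<forall>v\<in>verts G. card (nbrs G v) = k"
    using isomorphic_degree[OF f assms(2,3)] assms(4) f(1) by (auto simp: bij_betw_def)
  let ?S = "{v \<in> verts G. f v \<in> S}"
  have "f ` ?S = S" using f(1) assms(5) by (auto simp: bij_betw_def indep_def)
  moreover have "inj_on f ?S" using f(1) by (auto simp: bij_betw_def intro: inj_on_subset)
  ultimately have "card ?S = card S" by (metis card_image)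
  moreover have "indep G ?S" using f(2) assms(5) by (auto simp: indep_def nbrs_def)
  ultimately show "\<exists>S'. indep G S' \<and> card S' = card S" by blast
qed

lemma edges_complete: "{i, j} \<in> edges (complete_graph n) \<longleftrightarrow> i < n \<and> j < n \<and> i \<noteq> j"
  unfolding complete_graph_def by (auto simp: doubleton_eq_iff)

lemma nbrs_complete: "i < n \<Longrightarrow> nbrs (complete_graph n) i = {..<n} - {i}"
  by (auto simp: nbrs_def edges_complete)

lemma edges_cycle5: "edges (cycle_graph 5) = {{0, 1}, {1, 2}, {2, 3}, {3, 4}, {4, 0}}"
proof -
  have "edges (cycle_graph 5) = (\<lambda>i. {i, (i + 1) mod 5}) ` {..<5}"
    by (auto simp: cycle_graph_def)
  also have "{..<5::nat} = {0, 1, 2, 3, 4}" by auto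
  finally show ?thesis by (simp add: numeral_2_eq_2)
qed

lemma verts_cycle5: "verts (cycle_graph 5) = {0, 1, 2, 3, 4}"
  by (auto simp: cycle_graph_def)

lemma nbrs_two_K2:
  "nbrs two_K2 0 = {1}" "nbrs two_K2 (Suc 0) = {0}" "nbrs two_K2 2 = {3}" "nbrs two_K2 3 = {2}"
  by (auto simp: nbrs_def two_K2_def doubleton_eq_iff)

lemma nbrs_cycle5:
  "nbrs (cycle_graph 5) 0 = {1, 4}" "nbrs (cycle_graph 5) (Suc 0) = {0, 2}"
  "nbrs (cycle_graph 5) 2 = {1, 3}" "nbrs (cycle_graph 5) 3 = {2, 4}"
  "nbrs (cycle_graph 5) 4 = {3, 0}"
  by (auto simp: nbrs_def edges_cycle5 doubleton_eq_iff)

section \<open>Recognising the extremal graphs\<close>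

lemma regular_complete:
  assumes "finite_simple_graph G" "\<forall>v\<in>verts G. card (nbrs G v) + 1 = card (verts G)"
  shows "G \<cong>\<^sub>g complete_graph (card (verts G))"
proof -
  have fin: "finite (verts G)" using assms by (simp add: finite_simple_graph_def)
  have "nbrs G v = verts G - {v}" if "v \<in> verts G" for v
    using nbrs_subset[OF assms(1)] nbrs_irrefl[OF assms(1)] assms(2) that fin
    by (intro card_subset_eq) fastforce+
  then have adj: "{u, v} \<in> edges G \<longleftrightarrow> u \<noteq> v" if "u \<in> verts G" "v \<in> verts G" for u v
    using that by (auto simp: nbrs_def)
  obtain f where f: "bij_betw f (verts G) {..<card (verts G)}"
    using ex_bij_betw_finite_nat[OF fin] by (auto simp: atLeast0LessThan)
  have "{f u, f v} \<in> edges (complete_graph (card (verts G))) \<longleftrightarrow> u \<noteq> v"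
    if "u \<in> verts G" "v \<in> verts G" for u v
    using that f unfolding edges_complete by (auto simp: bij_betw_def inj_on_def)
  with f adj show ?thesis
    unfolding graph_isomorphic_def by (intro exI[of _ f]) (auto simp: complete_graph_def)
qed

text \<open>Every vertex is within distance two of a fixed \<open>v\<close> in the complement, so
  the two complement paths leaving \<open>v\<close> already exhaust the graph. They close up to a
  4-cycle, whose complement is \<open>two_K2\<close>, or to a 5-cycle, whose complement is again a
  5-cycle.\<close>

lemma (in alpha_critical) two_regular_complement:
  assumes \<alpha>: "\<alpha> = 2" and ne: "verts G \<noteq> {}"
    and deg: "\<forall>v\<in>verts G. card (nbrs G v) + 3 = card (verts G)"
  shows "G \<cong>\<^sub>g two_K2 \<or> G \<cong>\<^sub>g cycle_graph 5"
proof -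
  \<comment> \<open>\<open>M v\<close> is the neighbourhood of \<open>v\<close> in the complement of
    \<open>G\<close>.\<close>
  define M where "M v = verts G - insert v (nbrs G v)" for v
  have cM: "card (M v) = 2" if v: "v \<in> verts G" for v
  proof -
    have "insert v (nbrs G v) \<subseteq> verts G" using v nbrs_subset[OF simple] by blast
    moreover from this have "finite (nbrs G v)" using fin_verts finite_subset by auto
    ultimately show ?thesis
      using deg v nbrs_irrefl[OF simple, of v] unfolding M_def by (subst card_Diff_subset) auto
  qed
  have Msym: "u \<in> M v \<longleftrightarrow> v \<in> M u" if "u \<in> verts G" "v \<in> verts G" for u v
    using that nbrs_sym[of u G v] by (auto simp: M_def)
  have MV: "M v \<subseteq> verts G" and Mirr: "v \<notin> M v" for v by (auto simp: M_def)
  have adj: "{u, v} \<in> edges G \<longleftrightarrow> u \<noteq> v \<and> v \<notin> M u" if "u \<in> verts G" "v \<in> verts G" for u v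
    using that nbrs_irrefl[OF simple, of u] by (auto simp: M_def nbrs_def)
  have triangle: "b \<notin> M a" if "a \<in> M v" "b \<in> M v" "v \<in> verts G" for v a b
  proof
    assume b: "b \<in> M a"
    have "indep G {v, a, b}"
      using that b nbrs_irrefl[OF simple] nbrs_sym[of _ G] unfolding indep_def M_def by auto
    moreover have "card {v, a, b} = 3" using that b by (auto simp: M_def card_insert_if)
    ultimately show False using indep_le \<alpha> by fastforce
  qed
  \<comment> \<open>The critical set for the edge \<open>uw\<close> has two elements,
    \<open>w\<close> and some \<open>z\<close>; its only neighbour of \<open>u\<close> is
    \<open>w\<close>, so \<open>z\<close> is non-adjacent to both ends.\<close>
  have common: "\<exists>z. z \<in> M u \<and> z \<in> M w" if uw: "w \<in> nbrs G u" for u w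
  proof -
    obtain A where A: "indep G A" "card A = 2" "u \<notin> A" "A \<inter> nbrs G u = {w}"
      using critical[OF uw] \<alpha> by blast
    then have "w \<in> A" by blast
    with A(2) obtain z where z: "A = {w, z}" "z \<noteq> w" unfolding card_2_iff by blast
    with A have "z \<in> M u" "z \<in> M w" by (auto simp: indep_def M_def)
    then show ?thesis by blast
  qed
  have other: "\<exists>c. c \<noteq> a \<and> M v = {a, c}" if "a \<in> M v" "v \<in> verts G" for a v
    using cM[OF that(2)] that(1) unfolding card_2_iff by fastforce
  obtain v where v: "v \<in> verts G" using ne by blast
  obtain a b where ab: "M v = {a, b}" "a \<noteq> b" using cM[OF v] by (auto simp: card_2_iff)
  have aV: "a \<in> verts G" and bV: "b \<in> verts G" using MV[of v] ab by auto
  have "v \<in> M a" "v \<in> M b" using Msym[OF v] ab aV bV by auto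
  then obtain c d where c: "M a = {v, c}" "c \<noteq> v" and d: "M b = {v, d}" "d \<noteq> v"
    using other aV bV by metis
  have cV: "c \<in> verts G" and dV: "d \<in> verts G" using MV[of a] MV[of b] c d by auto
  have ca: "c \<noteq> a" and db: "d \<noteq> b" using Mirr[of a] Mirr[of b] c d by auto
  \<comment> \<open>Otherwise \<open>v\<close>, \<open>a\<close>, \<open>b\<close> would form a
    triangle in the complement.\<close>
  have cb: "c \<noteq> b" and da: "d \<noteq> a"
    using triangle[of a v b] triangle[of b v a] ab c d v by auto
  have va: "v \<noteq> a" "v \<noteq> b" using Mirr[of v] ab by auto
  have V: "verts G = {v, a, b, c, d}"
  proof (intro equalityI subsetI)
    fix w assume w: "w \<in> verts G"
    show "w \<in> {v, a, b, c, d}"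
    proof (cases "w \<in> nbrs G v")
      case True
      then obtain z where "z \<in> M v" "z \<in> M w" using common by blast
      then have "w \<in> M a \<or> w \<in> M b" using ab Msym w aV bV by auto
      then show ?thesis using c d by auto
    next
      case False
      then have "w = v \<or> w \<in> M v" using w by (auto simp: M_def)
      then show ?thesis using ab by auto
    qed
  qed (use v aV bV cV dV in auto)
  have Mc: "a \<in> M c" and Md: "b \<in> M d" using Msym aV bV cV dV c d by blast+
  have vc: "v \<notin> M c" "v \<notin> M d" using Msym[OF v cV] Msym[OF v dV] ab ca cb da db by auto
  show ?thesis
  proof (cases "c = d")
    case True
    then have "M c = {a, b}" using Mc Md ab cM[OF cV] unfolding card_2_iff by fastforce
    note M = this ab(1) c(1) d(1)[folded True]
    \<comment> \<open>The complement is the cycle v, a, c, b; the edges of \<open>G\<close> are its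
      diagonals \<open>vc\<close> and \<open>ab\<close>.\<close>
    define f :: "'a \<Rightarrow> nat" where "f x = (if x = v then 0 else if x = c then 1 else if x = a then 2 else 3)" for x
    have V4: "verts G = {v, a, b, c}" using V True by auto
    have f: "f v = 0" "f c = 1" "f a = 2" "f b = 3"
      using ab(2) va ca cb c(2) by (auto simp: f_def)
    have "bij_betw f (verts G) (verts two_K2)"
      unfolding bij_betw_def V4 two_K2_def using f by (auto simp: inj_on_def)
    moreover have "{x, y} \<in> edges G \<longleftrightarrow> {f x, f y} \<in> edges two_K2"
      if "x \<in> verts G" "y \<in> verts G" for x y
      unfolding adj[OF that]
      using that unfolding V4 two_K2_def
      by (elim insertE emptyE; simp add: M f ab(2) va ca cb c(2) doubleton_eq_iff
          ab(2)[symmetric] va[symmetric] ca[symmetric] cb[symmetric] c(2)[symmetric])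
    ultimately show ?thesis unfolding graph_isomorphic_def by blast
  next
    case False
    have bc: "b \<notin> M c" using Msym[OF bV cV] d False c by auto
    have ad: "a \<notin> M d" using Msym[OF aV dV] c False d by auto
    obtain x where x: "x \<noteq> a" "M c = {a, x}" using other[OF Mc cV] by blast
    then have "x \<in> verts G" "x \<noteq> c" "x \<noteq> v" "x \<noteq> b" using MV[of c] Mirr[of c] vc bc by auto
    then have Mcd: "M c = {a, d}" using x V by simp
    obtain y where y: "y \<noteq> b" "M d = {b, y}" using other[OF Md dV] by blast
    then have "y \<in> verts G" "y \<noteq> d" "y \<noteq> v" "y \<noteq> a" using MV[of d] Mirr[of d] vc ad by auto
    then have "M d = {b, c}" using y V by simp
    note M = this Mcd ab(1) c(1) d(1)
    \<comment> \<open>The complement is the cycle v, a, c, d, b. Taking every second vertex gives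
      the cycle v, c, b, a, d of \<open>G\<close>, numbered in this order.\<close>
    define f :: "'a \<Rightarrow> nat" where
      "f x = (if x = v then 0 else if x = c then 1 else if x = b then 2 else if x = a then 3 else 4)" for x
    have f: "f v = 0" "f c = 1" "f b = 2" "f a = 3" "f d = 4"
      using ab(2) va ca cb c(2) da db d(2) False by (auto simp: f_def)
    have "bij_betw f (verts G) (verts (cycle_graph 5))"
      unfolding bij_betw_def V verts_cycle5 using f by (auto simp: inj_on_def)
    moreover have "{x, y} \<in> edges G \<longleftrightarrow> {f x, f y} \<in> edges (cycle_graph 5)"
      if "x \<in> verts G" "y \<in> verts G" for x y
      unfolding adj[OF that]
      using that unfolding V edges_cycle5
      by (elim insertE emptyE; simp add: M f ab(2) va ca cb c(2) da db d(2) False doubleton_eq_iff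
          ab(2)[symmetric] va[symmetric] ca[symmetric] cb[symmetric] c(2)[symmetric]
          da[symmetric] db[symmetric] d(2)[symmetric] False[symmetric])
    ultimately show ?thesis unfolding graph_isomorphic_def by blast
  qed
qed

theorem theorem1:
  fixes G :: "'a ugraph" and t :: nat
  assumes "tau_critical G"
    and "transversal_number G = t"
  shows "card (verts G) + card (edges G) \<le> (t + 2) choose 2 \<and>
    (card (verts G) + card (edges G) = (t + 2) choose 2 \<longleftrightarrow>
      (\<exists>n\<ge>2. G \<cong>\<^sub>g complete_graph n) \<or> G \<cong>\<^sub>g two_K2 \<or> G \<cong>\<^sub>g cycle_graph 5)"
proof -
  let ?n = "card (verts G)"
  interpret alpha_critical G "?n - t"
    using tau_critical_alpha_critical(1)[OF assms(1)] assms(2) by simp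
  have tn: "t \<le> ?n" using tau_critical_alpha_critical(2)[OF assms(1)] assms(2) by simp
  have deg: "card (nbrs G v) + ?n \<le> 2 * t + 1" if "v \<in> verts G" for v
    using degree_bound[OF that] tn by linarith
  have indep_bound: "card S + t \<le> ?n" if "indep G S" for S
    using indep_le[OF that] tn by linarith
  show ?thesis
  proof (cases "verts G = {}")
    \<comment> \<open>The empty graph satisfies the bound strictly, since the binomial coefficient
      is positive, and none of the listed graphs is empty.\<close>
    case True
    then have "edges G = {}" using simple by (force simp: finite_simple_graph_def)
    moreover have "\<not> G \<cong>\<^sub>g H" if "verts H \<noteq> {}" for H :: "nat ugraph"
      using that True by (auto simp: graph_isomorphic_def bij_betw_def)
    moreover have "verts (complete_graph n) \<noteq> {}" if "n \<ge> 2" for n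
      using that by (auto simp: complete_graph_def lessThan_empty_iff)
    moreover have "verts two_K2 \<noteq> {}" "verts (cycle_graph 5) \<noteq> {}"
      by (auto simp: two_K2_def verts_cycle5)
    moreover have "(t + 2) choose 2 > 0" by simp
    ultimately show ?thesis using True by auto
  next
    case False
    note bound = order_plus_size[OF fin_verts False deg sum_degrees[OF simple]]
    have pos: "card (nbrs G v) > 0" if "v \<in> verts G" for v
      using nonisolated[OF that] nbrs_subset[OF simple] fin_verts
      by (meson card_gt_0_iff finite_subset)
    obtain v where v: "v \<in> verts G" using False by blast
    \<comment> \<open>The model attains Hajnal's bound with \<open>S\<close> in the role of a
      maximum independent set. In \<open>G\<close> this squeezes |S| \<le> n - t and k + n \<le> 2t
      + 1 into equalities, which fixes t without computing the transversal number of
      \<open>H\<close>.\<close>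
    have regularI: "?n + card (edges G) = (t + 2) choose 2"
      if "G \<cong>\<^sub>g H" "finite_simple_graph H" "\<forall>w\<in>verts H. card (nbrs H w) = k"
        "indep H S" "k + 2 * card S = card (verts H) + 1" "card S = 1 \<or> card S = 2"
      for H :: "nat ugraph" and k S
    proof -
      note iso = isomorphic_regular[OF that(1) simple that(2,3,4)]
      have "card S + t \<le> ?n" using iso(3) indep_bound by metis
      moreover have "k + ?n \<le> 2 * t + 1" using deg v iso(2) by metis
      ultimately have "?n = card S + t" "k + ?n = 2 * t + 1" using that(5) iso(1) by linarith+
      then show ?thesis using bound(2) that(6) iso(2) by auto
    qed
    have "(\<exists>n\<ge>2. G \<cong>\<^sub>g complete_graph n) \<or> G \<cong>\<^sub>g two_K2 \<or> G \<cong>\<^sub>g cycle_graph 5"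
      if eq: "?n + card (edges G) = (t + 2) choose 2"
    proof -
      have n: "?n = t + 1 \<or> ?n = t + 2" and reg: "\<forall>v\<in>verts G. card (nbrs G v) + ?n = 2 * t + 1"
        using bound(2) eq by blast+
      from n show ?thesis
      proof
        assume n: "?n = t + 1"
        then have "\<forall>v\<in>verts G. card (nbrs G v) + 1 = ?n" using reg by auto
        then have "G \<cong>\<^sub>g complete_graph ?n" using regular_complete[OF simple] by blast
        \<comment> \<open>The degree n - 1 is positive because no vertex is isolated.\<close>
        moreover have "?n \<ge> 2" using pos[OF v] reg v n by fastforce
        ultimately show ?thesis by blast
      next
        assume n: "?n = t + 2"
        \<comment> \<open>Here \<alpha> = 2 and the common degree 2t + 1 - n is n - 3, so the
          complement is 2-regular.\<close>
        then have "\<forall>v\<in>verts G. card (nbrs G v) + 3 = ?n" using reg by auto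
        then show ?thesis using two_regular_complement False n by simp
      qed
    qed
    moreover have "?n + card (edges G) = (t + 2) choose 2" if "n \<ge> 2" "G \<cong>\<^sub>g complete_graph n" for n
    \<comment> \<open>For the three models the equation k + 2|S| = n + 1 reads (n - 1) + 2 = n + 1,
      then 1 + 4 = 4 + 1, then 2 + 4 = 5 + 1.\<close>
    proof (rule regularI[OF that(2), of "n - 1" "{0}"])
      show "finite_simple_graph (complete_graph n)"
        by (auto simp: finite_simple_graph_def complete_graph_def)
      show "\<forall>w\<in>verts (complete_graph n). card (nbrs (complete_graph n) w) = n - 1"
        by (auto simp: nbrs_complete complete_graph_def[of n, THEN arg_cong[of _ _ verts]])
      show "indep (complete_graph n) {0}"
        using that(1) by (auto simp: indep_def nbrs_complete complete_graph_def nbrs_def)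
      show "n - 1 + 2 * card {0::nat} = card (verts (complete_graph n)) + 1"
        using that(1) by (simp add: complete_graph_def)
    qed simp
    moreover have "?n + card (edges G) = (t + 2) choose 2" if "G \<cong>\<^sub>g two_K2"
    proof (rule regularI[OF that, of 1 "{0, 2}"])
      show "finite_simple_graph two_K2"
        by (auto simp: finite_simple_graph_def two_K2_def)
      show "\<forall>w\<in>verts two_K2. card (nbrs two_K2 w) = 1"
        by (simp add: two_K2_def[THEN arg_cong[of _ _ verts]] nbrs_two_K2)
      show "indep two_K2 {0, 2}"
        by (simp add: indep_def two_K2_def[THEN arg_cong[of _ _ verts]] nbrs_two_K2)
      show "1 + 2 * card {0, 2::nat} = card (verts two_K2) + 1"
        by (simp add: two_K2_def)
    qed simp
    moreover have "?n + card (edges G) = (t + 2) choose 2" if "G \<cong>\<^sub>g cycle_graph 5"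
    proof (rule regularI[OF that, of 2 "{0, 2}"])
      show "finite_simple_graph (cycle_graph 5)"
        by (auto simp: finite_simple_graph_def edges_cycle5 verts_cycle5)
      show "\<forall>w\<in>verts (cycle_graph 5). card (nbrs (cycle_graph 5) w) = 2"
        by (simp add: verts_cycle5 nbrs_cycle5)
      show "indep (cycle_graph 5) {0, 2}"
        by (simp add: indep_def verts_cycle5 nbrs_cycle5)
      show "2 + 2 * card {0, 2::nat} = card (verts (cycle_graph 5)) + 1"
        by (simp add: verts_cycle5)
    qed simp
    ultimately show ?thesis using bound(1) by blast
  qed
qed

end
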